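(* For each dimension $d\ge2$ there is an appropriate constant $C_d>0$ depending only on $d$ such that the following holds. Let $\beta>0$, $q_2\in(-d,1]$ and $q_3\in(-2d,1]$. (i) For any $v\in\mathbb{R}^d$, $$\int_{\mathbb{R}^d}|u|^{q_2}e^{-\beta|v_1|^2}\,dv_1\le\widetilde K^2_{\beta,q_2}\,(1+|v|^{q_2^+}),$$ where $u=v_1-v$, $q_2^+=\max\{0,q_2\}$, and $$\widetilde K^2_{\beta,q_2}=C_d\Big[\big(1+\beta^{-d/2}+\beta^{-\frac{d+1}{2}}\big)\mathbf{1}_{q_2>0}+\Big(\beta^{-d/2}+\frac{1}{d+q_2}\Big)\mathbf{1}_{q_2\le0}\Big].$$ (ii) For any $v\in\mathbb{R}^d$, $$\int_{\mathbb{R}^{2d}}|\widetilde{\boldsymbol u}|^{q_3}e^{-\beta(|v_1|^2+|v_2|^2)}\,dv_1\,dv_2\le\widetilde K^3_{\beta,q_3}\,(1+|v|^{q_3^+}),$$ where $|\widetilde{\boldsymbol u}|=\sqrt{|v-v_1|^2+|v-v_2|^2+|v_1-v_2|^2}$, $q_3^+=\max\{0,q_3\}$, and $$\widetilde K^3_{\beta,q_3}=C_d\Big[\big(1+\beta^{-d}+\beta^{-\frac{2d+1}{2}}\big)\mathbf{1}_{q_3>0}+\Big(\beta^{-d}+\frac{1}{2d+q_3}\Big)\mathbf{1}_{q_3\le0}\Big].$$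
   Context: The superscripts $2$ and $3$ in $\widetilde K^2_{\beta,q_2}$, $\widetilde K^3_{\beta,q_3}$ are labels (binary, ternary), not powers. $\mathbf 1_{P}$ equals $1$ if the condition $P$ holds and $0$ otherwise; $|v|^0=1$ for every $v$. *)

theory Defs
  imports "HOL-Analysis.Analysis"
begin

text \<open>
  Real power with the convention that the zeroth power is 1 also at base 0, where \<open>powr\<close>
  gives 0. For a negative exponent and base 0 the value is 0 instead of infinity; such values
  are only ever taken on a Lebesgue null set of integration points.
\<close>
definition rpow :: "real \<Rightarrow> real \<Rightarrow> real" where
  "rpow r q = (if q = 0 then 1 else r powr q)"

definition pos_part :: "real \<Rightarrow> real" where
  "pos_part q = max 0 q"

definition tilde_u_norm :: "real ^ 'n \<Rightarrow> real ^ 'n \<Rightarrow> real ^ 'n \<Rightarrow> real" where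
  "tilde_u_norm v v1 v2 =
     sqrt ((norm (v - v1))\<^sup>2 + (norm (v - v2))\<^sup>2 + (norm (v1 - v2))\<^sup>2)"

definition K2 :: "real \<Rightarrow> nat \<Rightarrow> real \<Rightarrow> real \<Rightarrow> real" where
  "K2 C d \<beta> q =
     C * ((1 + \<beta> powr (- (real d / 2)) + \<beta> powr (- ((real d + 1) / 2))) * of_bool (q > 0)
        + (\<beta> powr (- (real d / 2)) + 1 / (real d + q)) * of_bool (q \<le> 0))"

definition K3 :: "real \<Rightarrow> nat \<Rightarrow> real \<Rightarrow> real \<Rightarrow> real" where
  "K3 C d \<beta> q =
     C * ((1 + \<beta> powr (- real d) + \<beta> powr (- ((2 * real d + 1) / 2))) * of_bool (q > 0)
        + (\<beta> powr (- real d) + 1 / (2 * real d + q)) * of_bool (q \<le> 0))"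

end

theory Submission
  imports Defs "HOL-Probability.Distributions"
begin

text \<open>
  Both estimates are the same estimate in a Euclidean space of dimension \<open>D\<close>: the first one in
  \<open>\<real>\<^sup>d\<close>, the second one in \<open>\<real>\<^sup>d \<times> \<real>\<^sup>d\<close> with the shift \<open>(v, v)\<close>, because the triangle
  expression \<open>tilde_u_norm v v1 v2\<close> lies between \<open>norm ((v1, v2) - (v, v))\<close> and \<open>sqrt 3\<close> times it,
  and because \<open>K3\<close> in dimension \<open>d\<close> is literally \<open>K2\<close> in dimension \<open>2 * d\<close>. So the core is the
  lemma \<open>shifted_power_gaussian_bound\<close>, which holds in every Euclidean space.

  For \<open>q > 0\<close> the map \<open>t \<mapsto> t powr q\<close> is subadditive, hence
  \<open>norm (x - v) powr q \<le> 1 + norm x + norm v powr q\<close>, and only the moments of order 0 and 1 of the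
  Gaussian are needed. They produce the powers \<open>- D / 2\<close> and \<open>- (D + 1) / 2\<close> of \<open>\<beta>\<close>. Using the
  first moment in place of the moment of order \<open>q\<close> is what keeps the constant independent of \<open>q\<close>.
  For \<open>q \<le> 0\<close> the integrand is at most the Gaussian itself where \<open>norm (x - v) > 1\<close>, and at most
  \<open>norm (x - v) powr q\<close> on the unit ball around \<open>v\<close>, where the integral is of order \<open>1 / (D + q)\<close>.

  The radial integrals are not computed in polar coordinates. A decreasing radial function
  is written as \<open>\<integral>t\<ge>norm x. g t\<close>, and Tonelli's theorem turns its integral into a
  one-dimensional one weighted by the volume of the ball of radius \<open>t\<close>
  (\<open>nn_integral_radial_tail\<close>). This gives \<open>nn_integral_exp_neg_norm\<close>, which dominates the Gaussian
  moments after completing a square, and \<open>nn_integral_powr_unit_cball\<close>.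
\<close>

section \<open>Integrals of radial functions\<close>

text \<open>
  The layer-cake formula: the point \<open>(x, t)\<close> contributes exactly when \<open>x\<close> lies in the closed ball
  of radius \<open>t\<close>, whose volume is a constant times the \<open>D\<close>-th power of \<open>t\<close>.
\<close>

lemma nn_integral_radial_tail:
  fixes g :: "real \<Rightarrow> ennreal"
  assumes [measurable]: "g \<in> borel_measurable borel"
  shows "(\<integral>\<^sup>+ x. (\<integral>\<^sup>+ t. g t * indicator {norm (x :: 'a :: euclidean_space)..} t \<partial>lborel) \<partial>lborel)
       = ennreal (unit_ball_vol (DIM('a)))
           * (\<integral>\<^sup>+ t. g t * ennreal (t ^ DIM('a)) * indicator {0..} t \<partial>lborel)"
proof -
  have "(\<integral>\<^sup>+ x. (\<integral>\<^sup>+ t. g t * indicator {norm (x :: 'a)..} t \<partial>lborel) \<partial>lborel)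
      = (\<integral>\<^sup>+ x. (\<integral>\<^sup>+ t. g t * indicator {p. norm (fst p :: 'a) \<le> snd p} (x, t) \<partial>lborel) \<partial>lborel)"
    by (intro nn_integral_cong) (auto simp: indicator_def)
  also have "\<dots> = (\<integral>\<^sup>+ t. (\<integral>\<^sup>+ x. g t * indicator {p. norm (fst p :: 'a) \<le> snd p} (x, t) \<partial>lborel) \<partial>lborel)"
    by (rule lborel_pair.Fubini'[symmetric]) measurable
  also have "\<dots> = (\<integral>\<^sup>+ t. ennreal (unit_ball_vol (DIM('a)))
                       * (g t * ennreal (t ^ DIM('a)) * indicator {0..} t) \<partial>lborel)"
  proof (rule nn_integral_cong)
    fix t :: real
    have "(\<integral>\<^sup>+ x. g t * indicator {p. norm (fst p :: 'a) \<le> snd p} (x, t) \<partial>lborel)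
        = (\<integral>\<^sup>+ x. g t * indicator (cball (0::'a) t) x \<partial>lborel)"
      by (intro nn_integral_cong) (auto simp: indicator_def)
    also have "\<dots> = g t * emeasure lborel (cball (0::'a) t)"
      by (subst nn_integral_cmult_indicator) auto
    also have "\<dots> = ennreal (unit_ball_vol (DIM('a)))
                       * (g t * ennreal (t ^ DIM('a)) * indicator {0..} t)"
      by (cases "t \<ge> 0") (auto simp: emeasure_cball ennreal_mult mult_ac)
    finally show "(\<integral>\<^sup>+ x. g t * indicator {p. norm (fst p :: 'a) \<le> snd p} (x, t) \<partial>lborel) = \<dots>" .
  qed
  also have "\<dots> = ennreal (unit_ball_vol (DIM('a)))
           * (\<integral>\<^sup>+ t. g t * ennreal (t ^ DIM('a)) * indicator {0..} t \<partial>lborel)"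
    by (rule nn_integral_cmult) measurable
  finally show ?thesis .
qed

text \<open>
  An exponential is its own tail integral, \<open>exp (- s * r) = \<integral>t\<ge>r. s * exp (- s * t)\<close>, so the layer-cake
  formula reduces the integral to the \<open>D\<close>-th moment of the exponential distribution.
\<close>

lemma nn_integral_exp_neg_norm:
  assumes "s > 0"
  shows "(\<integral>\<^sup>+ x. ennreal (exp (- s * norm (x :: 'a :: euclidean_space))) \<partial>lborel)
       = ennreal (unit_ball_vol (DIM('a)) * fact DIM('a) / s ^ DIM('a))"
proof -
  have tail: "(\<integral>\<^sup>+ t. ennreal (s * exp (- s * t)) * indicator {r..} t \<partial>lborel) = ennreal (exp (- s * r))" for r
  proof -
    have "(\<integral>\<^sup>+ t. ennreal (s * exp (- s * t)) * indicator {r..} t \<partial>lborel) = ennreal (0 - (- exp (- s * r)))"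
    proof (rule nn_integral_FTC_atLeast)
      have "((\<lambda>t. - exp (- s * t)) \<longlongrightarrow> - 0) at_top"
        using assms by (intro tendsto_minus filterlim_compose[OF exp_at_bot]
          filterlim_tendsto_neg_mult_at_bot[OF tendsto_const] filterlim_ident) auto
      then show "((\<lambda>t. - exp (- s * t)) \<longlongrightarrow> 0) at_top" by simp
    qed (use assms in \<open>auto intro!: derivative_eq_intros\<close>)
    then show ?thesis by simp
  qed
  have "(\<integral>\<^sup>+ x. ennreal (exp (- s * norm (x :: 'a))) \<partial>lborel)
      = (\<integral>\<^sup>+ x. (\<integral>\<^sup>+ t. ennreal (s * exp (- s * t)) * indicator {norm (x :: 'a)..} t \<partial>lborel) \<partial>lborel)"
    by (simp only: tail)
  also have "\<dots> = ennreal (unit_ball_vol (DIM('a)))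
      * (\<integral>\<^sup>+ t. ennreal (s * exp (- s * t)) * ennreal (t ^ DIM('a)) * indicator {0..} t \<partial>lborel)"
    by (rule nn_integral_radial_tail) measurable
  also have "(\<integral>\<^sup>+ t. ennreal (s * exp (- s * t)) * ennreal (t ^ DIM('a)) * indicator {0..} t \<partial>lborel)
      = (\<integral>\<^sup>+ t. ennreal (erlang_density 0 s t * t ^ DIM('a)) \<partial>lborel)"
    using assms by (intro nn_integral_cong)
      (auto simp: erlang_density_def indicator_def ennreal_mult'' mult_ac)
  also have "\<dots> = ennreal (fact DIM('a) / s ^ DIM('a))"
    using nn_integral_erlang_ith_moment[OF assms, of 0 "DIM('a)"] by simp
  finally show ?thesis
    by (simp add: ennreal_mult'[symmetric])
qed

text \<open>
  On the unit ball without its centre, \<open>norm x powr q = 1 + \<integral>t\<in>{norm x..1}. - q * t powr (q - 1)\<close>. The two summands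
  contribute the volume of the ball times \<open>1\<close> and times \<open>- q / (D + q)\<close>, which add up to \<open>D / (D + q)\<close>.
\<close>

lemma nn_integral_powr_unit_cball:
  fixes q :: real
  assumes q: "- real DIM('a :: euclidean_space) < q" "q \<le> 0"
  shows "(\<integral>\<^sup>+ x. ennreal (rpow (norm (x :: 'a)) q) * indicator (cball 0 1) x \<partial>lborel)
       \<le> ennreal (unit_ball_vol (DIM('a)) * DIM('a) / (DIM('a) + q))"
proof -
  define D where "D = real DIM('a)"
  define V where "V = unit_ball_vol D"
  have V: "V > 0" by (auto simp: V_def D_def)
  define g where "g t = ennreal (- q * t powr (q - 1)) * indicator {0..1} t" for t :: real
  have [measurable]: "g \<in> borel_measurable borel" unfolding g_def by measurable
  have pointwise: "ennreal (rpow (norm x) q) * indicator (cball 0 1) x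
      \<le> indicator (cball 0 1) x + (\<integral>\<^sup>+ t. g t * indicator {norm x..} t \<partial>lborel)" for x :: 'a
  proof (cases "x = 0 \<or> norm x > 1")
    case True
    then show ?thesis by (auto simp: rpow_def)
  next
    case False
    define r where "r = norm x"
    have r: "0 < r" "r \<le> 1" using False by (auto simp: r_def)
    have "(\<integral>\<^sup>+ t. g t * indicator {r..} t \<partial>lborel)
        = (\<integral>\<^sup>+ t. ennreal (- q * t powr (q - 1)) * indicator {r..1} t \<partial>lborel)"
      using r by (intro nn_integral_cong) (auto simp: g_def indicator_def)
    also have "\<dots> = ennreal (- (1 powr q) - - (r powr q))"
    proof (rule nn_integral_FTC_Icc)
      fix t assume "t \<in> {r..1}"
      then show "DERIV (\<lambda>t. - (t powr q)) t :> - q * t powr (q - 1)"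
        using r by (auto intro!: derivative_eq_intros)
    qed (use q r in \<open>auto simp: mult_nonpos_nonneg\<close>)
    finally have eq: "(\<integral>\<^sup>+ t. g t * indicator {r..} t \<partial>lborel) = ennreal (r powr q - 1)" by simp
    have "1 \<le> r powr q"
      using powr_mono2'[of q r 1] r q by simp
    then have "1 + ennreal (r powr q - 1) = ennreal (r powr q)"
      by (simp flip: ennreal_1 ennreal_plus)
    moreover have "rpow r q = r powr q" using r by (simp add: rpow_def)
    ultimately show ?thesis
      using eq r by (simp add: r_def[symmetric] indicator_def)
  qed
  \<comment> \<open>This integral converges at \<open>0\<close> because \<open>D + q > 0\<close>, and it is the source of the factor
    \<open>1 / (D + q)\<close>.\<close>
  have power_int: "(\<integral>\<^sup>+ t. g t * ennreal (t ^ DIM('a)) * indicator {0..} t \<partial>lborel) = ennreal (- q / (D + q))"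
  proof -
    have "(\<integral>\<^sup>+ t. g t * ennreal (t ^ DIM('a)) * indicator {0..} t \<partial>lborel)
        = (\<integral>\<^sup>+ t. ennreal (- q * t powr (D + q - 1)) * indicator {0..1} t \<partial>lborel)"
    proof (rule nn_integral_cong)
      fix t :: real
      show "g t * ennreal (t ^ DIM('a)) * indicator {0..} t
          = ennreal (- q * t powr (D + q - 1)) * indicator {0..1} t"
      proof (cases "0 < t \<and> t \<le> 1")
        case True
        then have "t ^ DIM('a) * t powr (q - 1) = t powr (D + q - 1)"
          by (simp add: powr_realpow[symmetric] powr_add[symmetric] D_def algebra_simps)
        with True have "- q * t powr (D + q - 1) = - q * t powr (q - 1) * t ^ DIM('a)"
          by (simp add: mult_ac)
        then have "ennreal (- q * t powr (D + q - 1))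
            = ennreal (- q * t powr (q - 1)) * ennreal (t ^ DIM('a))"
          using True by (simp only: ennreal_mult'' zero_le_power less_imp_le)
        with True show ?thesis
          by (simp add: g_def)
      next
        case False
        then show ?thesis by (auto simp: g_def indicator_def)
      qed
    qed
    also have "\<dots> = ennreal (- q * (1 powr (D + q - 1 + 1) / (D + q - 1 + 1)))"
      using q by (intro nn_integral_has_integral_lebesgue' has_integral_mult_right
        has_integral_powr_from_0) (auto simp: D_def mult_nonpos_nonneg)
    finally show ?thesis by simp
  qed
  have "(\<integral>\<^sup>+ x. ennreal (rpow (norm (x :: 'a)) q) * indicator (cball 0 1) x \<partial>lborel)
      \<le> (\<integral>\<^sup>+ x. indicator (cball 0 1) (x::'a) + (\<integral>\<^sup>+ t. g t * indicator {norm x..} t \<partial>lborel) \<partial>lborel)"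
    by (intro nn_integral_mono pointwise)
  also have "\<dots> = emeasure lborel (cball (0::'a) 1)
      + (\<integral>\<^sup>+ (x::'a). (\<integral>\<^sup>+ t. g t * indicator {norm x..} t \<partial>lborel) \<partial>lborel)"
  proof -
    \<comment> \<open>Measurability in \<open>x\<close> is visible only when the half-line depending on \<open>x\<close> is seen as a
      section of one closed subset of the product.\<close>
    have "(\<lambda>x::'a. \<integral>\<^sup>+ t. g t * indicator {p. norm (fst p :: 'a) \<le> snd p} (x, t) \<partial>lborel)
        \<in> borel_measurable lborel"
      by measurable
    also have "(\<lambda>x::'a. \<integral>\<^sup>+ t. g t * indicator {p. norm (fst p :: 'a) \<le> snd p} (x, t) \<partial>lborel)
        = (\<lambda>x. \<integral>\<^sup>+ t. g t * indicator {norm x..} t \<partial>lborel)"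
      by (intro ext nn_integral_cong) (auto simp: indicator_def)
    finally show ?thesis by (subst nn_integral_add) (auto intro!: borel_measurable_indicator)
  qed
  also have "\<dots> = ennreal V + ennreal V * ennreal (- q / (D + q))"
    by (simp add: nn_integral_radial_tail power_int emeasure_cball V_def D_def)
  also have "\<dots> = ennreal (V + V * (- q / (D + q)))"
  proof -
    have "0 \<le> - q / (D + q)" using q by (intro divide_nonneg_pos) (auto simp: D_def)
    then show ?thesis
      using V by (simp only: ennreal_mult[symmetric] ennreal_plus mult_nonneg_nonneg less_imp_le)
  qed
  also have "V + V * (- q / (D + q)) = V * D / (D + q)"
    using q by (simp add: D_def field_simps)
  finally show ?thesis by (simp add: V_def D_def)
qed

section \<open>Elementary inequalities for real powers\<close>

lemma rpow_nonneg [simp]: "rpow r q \<ge> 0"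
  by (simp add: rpow_def)

text \<open>
  Subadditivity of \<open>t \<mapsto> t powr q\<close> for \<open>0 < q \<le> 1\<close>, combined with \<open>a powr q \<le> 1 + a\<close>. The asymmetric
  form suits \<open>a = norm x\<close>, which is integrated, and \<open>b = norm v\<close>, whose power has to survive as it is.
\<close>

lemma rpow_add_le:
  assumes q: "0 < q" "q \<le> 1" and nn: "0 \<le> a" "0 \<le> b" "0 \<le> c" and c: "c \<le> a + b"
  shows "rpow c q \<le> 1 + a + rpow b q"
proof (cases "a + b = 0")
  case True
  then have "c = 0" using nn c by linarith
  then show ?thesis using q nn by (simp add: rpow_def)
next
  case False
  define S where "S = a + b"
  have S: "S > 0" using False nn by (simp add: S_def)
  have self_le: "x \<le> x powr q" if "0 \<le> x" "x \<le> 1" for x :: real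
    using powr_mono'[of q 1 x] that q by simp
  \<comment> \<open>On the unit interval \<open>x \<le> x powr q\<close>; applied to the two fractions of \<open>S\<close> this is
    subadditivity divided by \<open>S powr q\<close>.\<close>
  have "1 = a / S + b / S" using S by (simp add: S_def add_divide_distrib[symmetric])
  also have "\<dots> \<le> (a / S) powr q + (b / S) powr q"
    using nn S by (intro add_mono self_le) (auto simp: S_def)
  also have "\<dots> = (a powr q + b powr q) / S powr q"
    using nn S by (simp add: powr_divide add_divide_distrib)
  finally have "S powr q \<le> a powr q + b powr q"
    using S by (simp add: field_simps)
  moreover have "c powr q \<le> S powr q"
    using nn c q by (intro powr_mono2) (auto simp: S_def)
  moreover have "a powr q \<le> 1 + a"
  proof (cases "a \<le> 1")
    case True
    have "a powr q \<le> 1" using True q nn by (intro powr_le1) auto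
    then show ?thesis using nn by simp
  next
    case False
    then show ?thesis using powr_mono[of q 1 a] q by simp
  qed
  ultimately show ?thesis using q by (simp add: rpow_def)
qed

text \<open>
  Since \<open>rpow 0 q = 0\<close> for negative \<open>q\<close>, monotonicity fails at \<open>a = 0 < b\<close>; the last hypothesis
  excludes this case.
\<close>

lemma rpow_antimono:
  assumes "q \<le> 0" "0 \<le> a" "a \<le> b" "a = 0 \<Longrightarrow> b = 0"
  shows "rpow b q \<le> rpow a q"
proof (cases "a = 0")
  case False
  then show ?thesis using assms by (auto simp: rpow_def intro!: powr_mono2')
qed (use assms in simp)

lemma rpow_le_mult_rpow:
  assumes "0 < q" "q \<le> 1" "1 \<le> k" "0 \<le> a" "0 \<le> b" "b \<le> k * a"
  shows "rpow b q \<le> k * rpow a q"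
proof -
  have "b powr q \<le> (k * a) powr q" using assms by (intro powr_mono2) auto
  also have "\<dots> = k powr q * a powr q" using assms by (simp add: powr_mult)
  also have "\<dots> \<le> k * a powr q"
    using assms powr_mono[of q 1 k] by (intro mult_right_mono) auto
  finally show ?thesis using assms by (simp add: rpow_def)
qed

lemma rpow_measurable [measurable]: "(\<lambda>x. rpow (f x) q) \<in> borel_measurable M"
  if [measurable]: "f \<in> borel_measurable M"
  by (cases "q = 0") (simp_all add: rpow_def)

section \<open>Gaussian moments of order zero and one\<close>

text \<open>
  Completing the square, \<open>2 * s * r - s\<^sup>2 * r\<^sup>2 \<le> 1\<close>, bounds the Gaussian even by a multiple of
  \<open>exp (- 2 * s * r)\<close>. Half of this decay absorbs the factor \<open>s * r \<le> exp (s * r)\<close> in the second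
  estimate.
\<close>

lemma gaussian_le_exponential:
  assumes "s > 0" "r \<ge> (0::real)"
  shows "exp (- (s\<^sup>2) * r\<^sup>2) \<le> exp 1 * exp (- s * r)"
    and "r * exp (- (s\<^sup>2) * r\<^sup>2) \<le> exp 1 * (1 / s) * exp (- s * r)"
proof -
  have sq: "2 * (s * r) - (s * r)\<^sup>2 \<le> 1"
    using zero_le_power2[of "s * r - 1"] by (simp add: power2_eq_square algebra_simps)
  have nn: "s * r \<ge> 0" using assms by simp
  show "exp (- (s\<^sup>2) * r\<^sup>2) \<le> exp 1 * exp (- s * r)"
    using sq nn by (simp add: exp_add[symmetric] power_mult_distrib mult_ac)
  have "s * r \<le> exp (s * r)"
    using exp_ge_add_one_self[of "s * r"] by linarith
  then have "(s * r) * exp (- (s\<^sup>2) * r\<^sup>2) \<le> exp (s * r) * exp (- (s\<^sup>2) * r\<^sup>2)"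
    by (intro mult_right_mono) auto
  also have "\<dots> \<le> exp 1 * exp (- s * r)"
    using sq by (simp add: exp_add[symmetric] power_mult_distrib mult_ac)
  finally show "r * exp (- (s\<^sup>2) * r\<^sup>2) \<le> exp 1 * (1 / s) * exp (- s * r)"
    using assms by (simp add: field_simps)
qed

text \<open>
  With \<open>s = sqrt \<beta>\<close> the Gaussians are dominated by exponentials whose integral is a multiple of
  \<open>1 / s ^ D\<close>; the extra factor \<open>1 / s\<close> of the first moment gives the exponent \<open>D + 1\<close>.
\<close>

lemma nn_integral_gaussian:
  fixes \<beta> :: real
  assumes \<beta>: "\<beta> > 0"
  defines "C \<equiv> exp 1 * (unit_ball_vol (DIM('a :: euclidean_space)) * fact DIM('a))"
  shows "(\<integral>\<^sup>+ x. ennreal (exp (- \<beta> * (norm (x :: 'a))\<^sup>2)) \<partial>lborel)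
           \<le> ennreal (C * \<beta> powr (- (real DIM('a) / 2)))"
    and "(\<integral>\<^sup>+ x. ennreal (norm (x :: 'a) * exp (- \<beta> * (norm x)\<^sup>2)) \<partial>lborel)
           \<le> ennreal (C * \<beta> powr (- ((real DIM('a) + 1) / 2)))"
proof -
  define s where "s = sqrt \<beta>"
  have s: "s > 0" "s\<^sup>2 = \<beta>" using \<beta> by (auto simp: s_def)
  have s_powr: "s = \<beta> powr (1 / 2)" using \<beta> by (simp add: s_def powr_half_sqrt)
  have pow: "1 / s ^ n = \<beta> powr (- (real n / 2))" for n :: nat
    using \<beta> by (simp add: s_powr powr_powr powr_minus_divide flip: powr_realpow)
  have *: "(\<integral>\<^sup>+ x. ennreal (c * exp 1 * exp (- s * norm (x :: 'a))) \<partial>lborel)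
      = ennreal (c * (C / s ^ DIM('a)))" if "c \<ge> 0" for c
  proof -
    have "(\<integral>\<^sup>+ x. ennreal (c * exp 1 * exp (- s * norm (x :: 'a))) \<partial>lborel)
        = (\<integral>\<^sup>+ x. ennreal (c * exp 1) * ennreal (exp (- s * norm (x :: 'a))) \<partial>lborel)"
      using that by (simp add: ennreal_mult)
    also have "\<dots> = ennreal (c * exp 1) * (\<integral>\<^sup>+ x. ennreal (exp (- s * norm (x :: 'a))) \<partial>lborel)"
      by (rule nn_integral_cmult) measurable
    also have "\<dots> = ennreal (c * (C / s ^ DIM('a)))"
      using that s by (subst nn_integral_exp_neg_norm[OF s(1)], subst ennreal_mult[symmetric])
        (auto simp: C_def)
    finally show ?thesis .
  qed
  have "(\<integral>\<^sup>+ x. ennreal (exp (- \<beta> * (norm (x :: 'a))\<^sup>2)) \<partial>lborel)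
      \<le> (\<integral>\<^sup>+ x. ennreal (1 * exp 1 * exp (- s * norm (x :: 'a))) \<partial>lborel)"
    using gaussian_le_exponential(1)[OF s(1)] s(2)
    by (intro nn_integral_mono ennreal_leI) simp
  also have "\<dots> = ennreal (C * (1 / s ^ DIM('a)))" by (subst *) auto
  finally show "(\<integral>\<^sup>+ x. ennreal (exp (- \<beta> * (norm (x :: 'a))\<^sup>2)) \<partial>lborel)
           \<le> ennreal (C * \<beta> powr (- (real DIM('a) / 2)))" by (simp only: pow)
  have "(\<integral>\<^sup>+ x. ennreal (norm (x :: 'a) * exp (- \<beta> * (norm x)\<^sup>2)) \<partial>lborel)
      \<le> (\<integral>\<^sup>+ x. ennreal (1 / s * exp 1 * exp (- s * norm (x :: 'a))) \<partial>lborel)"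
    using gaussian_le_exponential(2)[OF s(1) norm_ge_zero] s(2)
    by (intro nn_integral_mono ennreal_leI) (simp add: mult_ac)
  also have "\<dots> = ennreal (C * (1 / s ^ Suc DIM('a)))" using s by (subst *) auto
  finally show "(\<integral>\<^sup>+ x. ennreal (norm (x :: 'a) * exp (- \<beta> * (norm x)\<^sup>2)) \<partial>lborel)
           \<le> ennreal (C * \<beta> powr (- ((real DIM('a) + 1) / 2)))"
    by (simp only: pow) (simp add: add.commute)
qed

section \<open>The estimate in an arbitrary Euclidean space\<close>

lemma K2_nonneg: "C \<ge> 0 \<Longrightarrow> q > - real d \<Longrightarrow> K2 C d \<beta> q \<ge> 0"
  by (auto simp: K2_def intro!: mult_nonneg_nonneg add_nonneg_nonneg)

lemma shifted_power_gaussian_bound_pos: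
  fixes v :: "'a :: euclidean_space"
  assumes \<beta>: "\<beta> > 0" and q: "0 < q" "q \<le> 1"
  defines "C \<equiv> exp 1 * (unit_ball_vol (DIM('a)) * fact DIM('a))"
  shows "(\<integral>\<^sup>+ x. ennreal (rpow (norm (x - v)) q * exp (- \<beta> * (norm x)\<^sup>2)) \<partial>lborel)
       \<le> ennreal (K2 C DIM('a) \<beta> q * (1 + rpow (norm v) q))"
proof -
  define R where "R = rpow (norm v) q"
  define A where "A = \<beta> powr (- (real DIM('a) / 2))"
  define B where "B = \<beta> powr (- ((real DIM('a) + 1) / 2))"
  have nn: "R \<ge> 0" "A \<ge> 0" "B \<ge> 0" "C \<ge> 0" by (auto simp: R_def A_def B_def C_def)
  have "(\<integral>\<^sup>+ x. ennreal (rpow (norm (x - v)) q * exp (- \<beta> * (norm x)\<^sup>2)) \<partial>lborel)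
      \<le> (\<integral>\<^sup>+ (x::'a). ennreal (1 + R) * ennreal (exp (- \<beta> * (norm x)\<^sup>2))
            + ennreal (norm x * exp (- \<beta> * (norm x)\<^sup>2)) \<partial>lborel)"
  proof (rule nn_integral_mono)
    fix x :: 'a
    have "rpow (norm (x - v)) q \<le> 1 + norm x + R"
      unfolding R_def using q by (intro rpow_add_le norm_triangle_ineq4) auto
    then have "rpow (norm (x - v)) q * exp (- \<beta> * (norm x)\<^sup>2)
        \<le> (1 + norm x + R) * exp (- \<beta> * (norm x)\<^sup>2)"
      by (intro mult_right_mono) auto
    also have "\<dots> = (1 + R) * exp (- \<beta> * (norm x)\<^sup>2) + norm x * exp (- \<beta> * (norm x)\<^sup>2)"
      by (simp add: algebra_simps)
    finally show "ennreal (rpow (norm (x - v)) q * exp (- \<beta> * (norm x)\<^sup>2))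
        \<le> ennreal (1 + R) * ennreal (exp (- \<beta> * (norm x)\<^sup>2))
            + ennreal (norm x * exp (- \<beta> * (norm x)\<^sup>2))"
      using nn by (simp add: ennreal_mult[symmetric] ennreal_leI del: ennreal_plus flip: ennreal_plus)
  qed
  also have "\<dots> = ennreal (1 + R) * (\<integral>\<^sup>+ (x::'a). ennreal (exp (- \<beta> * (norm x)\<^sup>2)) \<partial>lborel)
            + (\<integral>\<^sup>+ (x::'a). ennreal (norm x * exp (- \<beta> * (norm x)\<^sup>2)) \<partial>lborel)"
    by (subst nn_integral_add, measurable, subst nn_integral_cmult, measurable)
  also have "\<dots> \<le> ennreal (1 + R) * ennreal (C * A) + ennreal (C * B)"
    unfolding A_def B_def C_def
    by (intro add_mono mult_left_mono nn_integral_gaussian \<beta>) auto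
  also have "\<dots> = ennreal ((1 + R) * (C * A) + C * B)"
    using nn by (simp add: ennreal_mult[symmetric] del: ennreal_plus flip: ennreal_plus)
  also have "\<dots> \<le> ennreal (C * (1 + A + B) * (1 + R))"
    using nn by (intro ennreal_leI) (simp add: algebra_simps)
  also have "C * (1 + A + B) * (1 + R) = K2 C DIM('a) \<beta> q * (1 + rpow (norm v) q)"
    using q by (simp add: K2_def A_def B_def R_def)
  finally show ?thesis .
qed

text \<open>
  The singularity is integrated over the unit ball around \<open>v\<close> without the Gaussian, so that
  translation invariance of Lebesgue measure removes \<open>v\<close> altogether.
\<close>

lemma shifted_power_gaussian_bound_nonpos:
  fixes v :: "'a :: euclidean_space"
  assumes \<beta>: "\<beta> > 0" and q: "- real DIM('a) < q" "q \<le> 0"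
  defines "C \<equiv> exp 1 * (unit_ball_vol (DIM('a)) * fact DIM('a))"
  shows "(\<integral>\<^sup>+ x. ennreal (rpow (norm (x - v)) q * exp (- \<beta> * (norm x)\<^sup>2)) \<partial>lborel)
       \<le> ennreal (K2 C DIM('a) \<beta> q)"
proof -
  define f where "f x = ennreal (rpow (norm x) q) * indicator (cball 0 1) x" for x :: 'a
  have [measurable]: "cball (0::'a) 1 \<in> sets borel" by (intro borel_closed closed_cball)
  have [measurable]: "f \<in> borel_measurable borel" unfolding f_def by measurable
  have "(\<integral>\<^sup>+ x. ennreal (rpow (norm (x - v)) q * exp (- \<beta> * (norm x)\<^sup>2)) \<partial>lborel)
      \<le> (\<integral>\<^sup>+ x. ennreal (exp (- \<beta> * (norm x)\<^sup>2)) + f (- v + x) \<partial>lborel)"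
  proof (rule nn_integral_mono)
    fix x :: 'a
    show "ennreal (rpow (norm (x - v)) q * exp (- \<beta> * (norm x)\<^sup>2))
        \<le> ennreal (exp (- \<beta> * (norm x)\<^sup>2)) + f (- v + x)"
    proof (cases "norm (x - v) \<le> 1")
      case True
      have "rpow (norm (x - v)) q * exp (- \<beta> * (norm x)\<^sup>2) \<le> rpow (norm (x - v)) q * 1"
        using \<beta> by (intro mult_left_mono) auto
      then show ?thesis using True
        by (auto simp: f_def intro!: add_increasing ennreal_leI)
    next
      case False
      have "rpow (norm (x - v)) q \<le> rpow 1 q"
        using False q by (intro rpow_antimono) auto
      then have "rpow (norm (x - v)) q * exp (- \<beta> * (norm x)\<^sup>2) \<le> 1 * exp (- \<beta> * (norm x)\<^sup>2)"
        by (intro mult_right_mono) (auto simp: rpow_def split: if_splits)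
      then show ?thesis by (auto intro!: add_increasing2 ennreal_leI)
    qed
  qed
  also have "\<dots> = (\<integral>\<^sup>+ (x::'a). ennreal (exp (- \<beta> * (norm x)\<^sup>2)) \<partial>lborel) + (\<integral>\<^sup>+ x. f (- v + x) \<partial>lborel)"
    by (rule nn_integral_add) measurable
  also have "(\<integral>\<^sup>+ x. f (- v + x) \<partial>lborel) = (\<integral>\<^sup>+ x. f x \<partial>(distr lborel borel ((+) (- v))))"
    by (rule nn_integral_distr[symmetric]) measurable
  also have "\<dots> = (\<integral>\<^sup>+ x. f x \<partial>lborel)" by (simp only: lborel_distr_plus)
  also have "(\<integral>\<^sup>+ (x::'a). ennreal (exp (- \<beta> * (norm x)\<^sup>2)) \<partial>lborel) + \<dots>
      \<le> ennreal (C * \<beta> powr (- (real DIM('a) / 2)))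
        + ennreal (unit_ball_vol (DIM('a)) * DIM('a) / (DIM('a) + q))"
    unfolding C_def f_def using q
    by (intro add_mono nn_integral_gaussian \<beta> nn_integral_powr_unit_cball) auto
  also have "\<dots> = ennreal (C * \<beta> powr (- (real DIM('a) / 2))
        + unit_ball_vol (DIM('a)) * DIM('a) / (DIM('a) + q))"
    using q by (subst ennreal_plus) (auto simp: C_def)
  also have "\<dots> \<le> ennreal (C * \<beta> powr (- (real DIM('a) / 2)) + C / (DIM('a) + q))"
  proof -
    \<comment> \<open>The constant of the Gaussian part also serves for the singular part, since \<open>D \<le> D!\<close>.\<close>
    have "real DIM('a) \<le> fact DIM('a)"
      by (metis fact_ge_self of_nat_fact of_nat_le_iff)
    also have "\<dots> \<le> exp 1 * fact DIM('a)"
      by simp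
    finally have "unit_ball_vol (DIM('a)) * DIM('a) \<le> C"
      by (simp add: C_def mult_left_mono mult.left_commute)
    then show ?thesis using q by (intro ennreal_leI add_left_mono divide_right_mono) auto
  qed
  also have "C * \<beta> powr (- (real DIM('a) / 2)) + C / (DIM('a) + q) = K2 C DIM('a) \<beta> q"
    using q by (simp add: K2_def algebra_simps)
  finally show ?thesis .
qed

lemma shifted_power_gaussian_bound:
  fixes v :: "'a :: euclidean_space"
  assumes \<beta>: "\<beta> > 0" and q: "- real DIM('a) < q" "q \<le> 1"
  defines "C \<equiv> exp 1 * (unit_ball_vol (DIM('a)) * fact DIM('a))"
  shows "(\<integral>\<^sup>+ x. ennreal (rpow (norm (x - v)) q * exp (- \<beta> * (norm x)\<^sup>2)) \<partial>lborel)
       \<le> ennreal (K2 C DIM('a) \<beta> q * (1 + rpow (norm v) (pos_part q)))"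
proof (cases "q > 0")
  case True
  then have "pos_part q = q" by (simp add: pos_part_def)
  then show ?thesis
    unfolding C_def using shifted_power_gaussian_bound_pos[OF \<beta> True q(2), of v] by simp
next
  case False
  then have q': "q \<le> 0" by simp
  have "K2 C DIM('a) \<beta> q \<ge> 0" using q by (intro K2_nonneg) (auto simp: C_def)
  then have "K2 C DIM('a) \<beta> q * 1 \<le> K2 C DIM('a) \<beta> q * (1 + rpow (norm v) (pos_part q))"
    by (intro mult_left_mono) auto
  then show ?thesis
    using shifted_power_gaussian_bound_nonpos[OF \<beta> q(1) q', of v] unfolding C_def
    by (simp add: order_trans[OF _ ennreal_leI])
qed

section \<open>Reduction of the ternary kernel to the product space\<close>

lemma K3_eq_K2: "K3 C d \<beta> q = K2 C (2 * d) \<beta> q"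
  by (simp add: K3_def K2_def)

lemma K2_mono_const: "C \<le> C' \<Longrightarrow> q > - real d \<Longrightarrow> K2 C d \<beta> q \<le> K2 C' d \<beta> q"
  unfolding K2_def by (intro mult_right_mono) (auto intro!: add_nonneg_nonneg)

lemma K2_scale: "K2 (a * C) d \<beta> q = a * K2 C d \<beta> q"
  by (simp add: K2_def)

text \<open>
  With \<open>a = v1 - v\<close> and \<open>b = v2 - v\<close> the third side of the triangle is \<open>a - b\<close>, and the parallelogram
  identity bounds its square by twice the sum of the other two squares.
\<close>

lemma tilde_u_norm_bounds:
  fixes v v1 v2 :: "real ^ 'n"
  shows "norm ((v1, v2) - (v, v)) \<le> tilde_u_norm v v1 v2"
    and "tilde_u_norm v v1 v2 \<le> sqrt 3 * norm ((v1, v2) - (v, v))"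
proof -
  define a b where "a = v1 - v" and "b = v2 - v"
  have eq: "tilde_u_norm v v1 v2 = sqrt ((norm a)\<^sup>2 + (norm b)\<^sup>2 + (norm (a - b))\<^sup>2)"
    by (simp add: tilde_u_norm_def a_def b_def norm_minus_commute)
  have pr: "norm ((v1, v2) - (v, v)) = sqrt ((norm a)\<^sup>2 + (norm b)\<^sup>2)"
    by (simp add: a_def b_def norm_Pair)
  show "norm ((v1, v2) - (v, v)) \<le> tilde_u_norm v v1 v2"
    unfolding eq pr by (intro real_sqrt_le_mono) simp
  have "(norm (a - b))\<^sup>2 + (norm (a + b))\<^sup>2 = 2 * (norm a)\<^sup>2 + 2 * (norm b)\<^sup>2"
    by (simp add: power2_norm_eq_inner inner_simps inner_commute)
  then have "(norm (a - b))\<^sup>2 \<le> 2 * (norm a)\<^sup>2 + 2 * (norm b)\<^sup>2"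
    using zero_le_power2[of "norm (a + b)"] by linarith
  then have "sqrt ((norm a)\<^sup>2 + (norm b)\<^sup>2 + (norm (a - b))\<^sup>2) \<le> sqrt (3 * ((norm a)\<^sup>2 + (norm b)\<^sup>2))"
    by (intro real_sqrt_le_mono) simp
  then show "tilde_u_norm v v1 v2 \<le> sqrt 3 * norm ((v1, v2) - (v, v))"
    by (simp only: eq pr real_sqrt_mult)
qed

text \<open>
  For \<open>q > 0\<close> the upper bound for \<open>tilde_u_norm\<close> is used, for \<open>q \<le> 0\<close> the lower one; at the point
  \<open>v1 = v2 = v\<close> both norms vanish together, as antitonicity of \<open>rpow\<close> requires.
\<close>

lemma rpow_tilde_u_norm_le:
  fixes v v1 v2 :: "real ^ 'n"
  assumes "q \<le> 1"
  shows "rpow (tilde_u_norm v v1 v2) q \<le> sqrt 3 * rpow (norm ((v1, v2) - (v, v))) q"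
proof (cases "q > 0")
  case True
  then show ?thesis
    using assms by (intro rpow_le_mult_rpow tilde_u_norm_bounds) (auto simp: tilde_u_norm_def)
next
  case False
  have "tilde_u_norm v v1 v2 = 0" if "norm ((v1, v2) - (v, v)) = 0"
    using tilde_u_norm_bounds(1)[where v = v and ?v1.0 = v1 and ?v2.0 = v2]
      tilde_u_norm_bounds(2)[where v = v and ?v1.0 = v1 and ?v2.0 = v2] that by simp
  then have "rpow (tilde_u_norm v v1 v2) q \<le> 1 * rpow (norm ((v1, v2) - (v, v))) q"
    using False by (simp only: mult_1, intro rpow_antimono tilde_u_norm_bounds) auto
  also have "\<dots> \<le> sqrt 3 * rpow (norm ((v1, v2) - (v, v))) q"
    by (intro mult_right_mono) auto
  finally show ?thesis .
qed

lemma rpow_norm_diagonal_le: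
  fixes v :: "real ^ 'n"
  assumes "q \<le> 1"
  shows "1 + rpow (norm (v, v)) (pos_part q) \<le> sqrt 2 * (1 + rpow (norm v) (pos_part q))"
proof -
  have n: "norm (v, v) = sqrt 2 * norm v"
    by (simp add: norm_Pair real_sqrt_mult flip: mult_2)
  have "rpow (norm (v, v)) (pos_part q) \<le> sqrt 2 * rpow (norm v) (pos_part q)"
  proof (cases "q > 0")
    case True
    then show ?thesis using assms n by (intro rpow_le_mult_rpow) (auto simp: pos_part_def)
  qed (simp add: pos_part_def rpow_def)
  moreover have "1 \<le> sqrt 2" by simp
  ultimately show ?thesis by (simp only: distrib_left mult_1_right add_mono)
qed

section \<open>The two moment estimates\<close>

theorem lemma3p2:
  assumes "CARD('n::finite) \<ge> 2"
  shows "\<exists>C>0. \<forall>\<beta>>0. \<forall>q2 \<in> {- real CARD('n)<..1}. \<forall>q3 \<in> {- 2 * real CARD('n)<..1}.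
    (\<forall>v :: real ^ 'n.
       (\<integral>\<^sup>+ v1. ennreal (rpow (norm (v1 - v)) q2 * exp (- \<beta> * (norm v1)\<^sup>2)) \<partial>lborel)
         \<le> ennreal (K2 C CARD('n) \<beta> q2 * (1 + rpow (norm v) (pos_part q2)))) \<and>
    (\<forall>v :: real ^ 'n.
       (\<integral>\<^sup>+ (v1, v2). ennreal (rpow (tilde_u_norm v v1 v2) q3
                            * exp (- \<beta> * ((norm v1)\<^sup>2 + (norm v2)\<^sup>2)))
          \<partial>(lborel :: ((real ^ 'n) \<times> (real ^ 'n)) measure))
         \<le> ennreal (K3 C CARD('n) \<beta> q3 * (1 + rpow (norm v) (pos_part q3))))"
proof -
  let ?d = "CARD('n)"
  define C2 where "C2 = exp 1 * (unit_ball_vol (real ?d) * fact ?d)"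
  define C3 where "C3 = exp 1 * (unit_ball_vol (real (2 * ?d)) * fact (2 * ?d))"
  \<comment> \<open>The factors \<open>sqrt 3\<close> and \<open>sqrt 2\<close> come from replacing the triangle expression by the norm of
    the product space and \<open>norm (v, v)\<close> by \<open>norm v\<close>.\<close>
  define C where "C = max C2 (sqrt 3 * sqrt 2 * C3)"
  have C3: "C3 > 0" by (simp add: C3_def)
  have "C2 > 0" by (simp add: C2_def)
  then have C: "C > 0" by (simp add: C_def)
  show ?thesis
  proof (intro exI[of _ C] conjI C allI impI ballI)
    fix \<beta> q2 q3 :: real and v :: "real ^ 'n"
    assume \<beta>: "\<beta> > 0" and q2: "q2 \<in> {- real ?d<..1}"
    have "(\<integral>\<^sup>+ v1. ennreal (rpow (norm (v1 - v)) q2 * exp (- \<beta> * (norm v1)\<^sup>2)) \<partial>lborel)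
        \<le> ennreal (K2 C2 ?d \<beta> q2 * (1 + rpow (norm v) (pos_part q2)))"
      using shifted_power_gaussian_bound[OF \<beta>, of q2 v] q2 by (simp add: C2_def)
    also have "\<dots> \<le> ennreal (K2 C ?d \<beta> q2 * (1 + rpow (norm v) (pos_part q2)))"
      using q2 by (intro ennreal_leI mult_right_mono K2_mono_const) (auto simp: C_def)
    finally show "(\<integral>\<^sup>+ v1. ennreal (rpow (norm (v1 - v)) q2 * exp (- \<beta> * (norm v1)\<^sup>2)) \<partial>lborel) \<le> \<dots>" .
  next
    fix \<beta> q2 q3 :: real and v :: "real ^ 'n"
    assume \<beta>: "\<beta> > 0" and "q3 \<in> {- 2 * real ?d<..1}"
    then have q3: "- real (2 * ?d) < q3" "q3 \<le> 1" by auto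
    let ?G = "\<lambda>w :: (real ^ 'n) \<times> (real ^ 'n). rpow (norm (w - (v, v))) q3 * exp (- \<beta> * (norm w)\<^sup>2)"
    have dim: "DIM((real ^ 'n) \<times> (real ^ 'n)) = 2 * ?d" by simp
    have K: "K2 C3 (2 * ?d) \<beta> q3 \<ge> 0" using q3 C3 by (intro K2_nonneg) auto
    have "(\<integral>\<^sup>+ (v1, v2). ennreal (rpow (tilde_u_norm v v1 v2) q3
                            * exp (- \<beta> * ((norm v1)\<^sup>2 + (norm v2)\<^sup>2))) \<partial>lborel)
        \<le> (\<integral>\<^sup>+ w. ennreal (sqrt 3) * ennreal (?G w) \<partial>lborel)"
    proof (rule nn_integral_mono)
      fix w :: "(real ^ 'n) \<times> (real ^ 'n)"
      obtain v1 v2 where w: "w = (v1, v2)" by (cases w)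
      have "rpow (tilde_u_norm v v1 v2) q3 * exp (- \<beta> * (norm w)\<^sup>2)
          \<le> (sqrt 3 * rpow (norm (w - (v, v))) q3) * exp (- \<beta> * (norm w)\<^sup>2)"
        unfolding w using q3 by (intro mult_right_mono rpow_tilde_u_norm_le) auto
      also have "\<dots> = sqrt 3 * ?G w" by (rule mult.assoc)
      finally have "ennreal (rpow (tilde_u_norm v v1 v2) q3 * exp (- \<beta> * (norm w)\<^sup>2))
          \<le> ennreal (sqrt 3) * ennreal (?G w)"
        by (subst ennreal_mult[symmetric]) (auto intro!: ennreal_leI)
      then show "(case w of (v1, v2) \<Rightarrow> ennreal (rpow (tilde_u_norm v v1 v2) q3
                            * exp (- \<beta> * ((norm v1)\<^sup>2 + (norm v2)\<^sup>2))))
          \<le> ennreal (sqrt 3) * ennreal (?G w)"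
        by (simp add: w norm_Pair)
    qed
    also have "\<dots> = ennreal (sqrt 3) * (\<integral>\<^sup>+ w. ennreal (?G w) \<partial>lborel)"
      by (rule nn_integral_cmult) measurable
    also have "\<dots> \<le> ennreal (sqrt 3) * ennreal (K2 C3 (2 * ?d) \<beta> q3 * (1 + rpow (norm (v, v)) (pos_part q3)))"
      using shifted_power_gaussian_bound[OF \<beta>, of q3 "(v, v)", unfolded dim, folded C3_def] q3
      by (intro mult_left_mono) auto
    also have "\<dots> = ennreal (sqrt 3 * (K2 C3 (2 * ?d) \<beta> q3 * (1 + rpow (norm (v, v)) (pos_part q3))))"
      using K by (intro ennreal_mult[symmetric] mult_nonneg_nonneg) auto
    also have "\<dots> \<le> ennreal (sqrt 3 * (K2 C3 (2 * ?d) \<beta> q3 * (sqrt 2 * (1 + rpow (norm v) (pos_part q3)))))"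
      using K q3 by (intro ennreal_leI mult_left_mono rpow_norm_diagonal_le) auto
    also have "\<dots> = ennreal (K2 (sqrt 3 * sqrt 2 * C3) (2 * ?d) \<beta> q3 * (1 + rpow (norm v) (pos_part q3)))"
      by (subst K2_scale) (simp only: mult_ac)
    also have "\<dots> \<le> ennreal (K2 C (2 * ?d) \<beta> q3 * (1 + rpow (norm v) (pos_part q3)))"
      using q3 by (intro ennreal_leI mult_right_mono K2_mono_const) (auto simp: C_def)
    finally show "(\<integral>\<^sup>+ (v1, v2). ennreal (rpow (tilde_u_norm v v1 v2) q3
                            * exp (- \<beta> * ((norm v1)\<^sup>2 + (norm v2)\<^sup>2)))
          \<partial>(lborel :: ((real ^ 'n) \<times> (real ^ 'n)) measure))
         \<le> ennreal (K3 C ?d \<beta> q3 * (1 + rpow (norm v) (pos_part q3)))"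
      by (simp only: K3_eq_K2)
  qed
qed

end
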